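(* Let $p$ be an odd prime and for $q\in\{1,\dots,(p-1)/2\}$ let $\omega_{p/q}=e^{2\pi i q/p}$. Let $G'$ be an all-regular substructure of an oriented graph that contains no $p$-vanishing unicyclic component, and let $n_\ast$ be the number of (necessarily non-$p$-vanishing) unicyclic components of $G'$. Then $$\prod_{q=1}^{(p-1)/2}\det L_{\omega_{p/q}}(G')=p^{\,n_\ast},\qquad\text{i.e. } n_\ast=\log_p\Big(\prod_{q=1}^{(p-1)/2}\det L_{\omega_{p/q}}(G')\Big).$$
   Context: An oriented graph $G=(V,E)$ is a finite directed graph with no loops, no multiple arcs, and no pair of opposite arcs. A substructure is $(V',E')$ with $V'\subseteq V$, $E'\subseteq E$ (arcs may leave $V'$); for $|\omega|=1$ its Hermitian Laplacian $L_\omega((V',E'))$ is the $V'\times V'$ matrix with diagonal entry at $u$ the number of arcs of $E'$ incident with $u$, and $(u,v)$ entry ($u\ne v$) $-\omega$ if some arc of $E'$ goes $u\to v$, $-\overline\omega$ if some arc of $E'$ goes $v\to u$, $0$ otherwise. Its connected components are the classes $V'_i$ of vertices of $V'$ joined by paths (ignoring directions) with vertices in $V'$ and arcs in $E'$, together with the arcs $E'_i$ of $E'$ having an endpoint in $V'_i$; it is all-regular if $|V'_i|=|E'_i|$ for all $i$. A unicyclic component is a component whose arcs have both ends in $V'_i$ and whose underlying graph is connected with exactly one cycle. For a cycle of length $k$, traverse it in the direction for which the number $g$ of arcs oriented against the traversal (negative arcs) satisfies $0\le g\le\lfloor k/2\rfloor$. A unicyclic component with cycle length $k$ and $g$ negative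 arcs is $p$-vanishing if $p\mid k-2g$ and non-$p$-vanishing otherwise. *)

theory Defs
  imports "HOL-Analysis.Analysis" "HOL-Combinatorics.Permutations"
begin

text \<open>Oriented graph: finite vertex set, arcs are ordered pairs of vertices,
  no loops, no pair of opposite arcs (multiple arcs are excluded by using a set).\<close>
definition oriented_graph :: "'a set \<Rightarrow> ('a \<times> 'a) set \<Rightarrow> bool" where
  "oriented_graph V E \<longleftrightarrow> finite V \<and> E \<subseteq> V \<times> V \<and>
     (\<forall>(u,v)\<in>E. u \<noteq> v \<and> (v,u) \<notin> E)"

definition substructure :: "'a set \<Rightarrow> ('a \<times> 'a) set \<Rightarrow> 'a set \<Rightarrow> ('a \<times> 'a) set \<Rightarrow> bool" where
  "substructure V E V' E' \<longleftrightarrow> V' \<subseteq> V \<and> E' \<subseteq> E"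

definition arc_degree :: "('a \<times> 'a) set \<Rightarrow> 'a \<Rightarrow> nat" where
  "arc_degree E' u = card {e \<in> E'. fst e = u \<or> snd e = u}"

definition herm_laplacian :: "complex \<Rightarrow> ('a \<times> 'a) set \<Rightarrow> 'a \<Rightarrow> 'a \<Rightarrow> complex" where
  "herm_laplacian \<omega> E' u v =
     (if u = v then of_nat (arc_degree E' u)
      else if (u,v) \<in> E' then - \<omega>
      else if (v,u) \<in> E' then - cnj \<omega>
      else 0)"

definition det_on :: "'a set \<Rightarrow> ('a \<Rightarrow> 'a \<Rightarrow> complex) \<Rightarrow> complex" where
  "det_on I M = (\<Sum>\<sigma> | \<sigma> permutes I. of_int (sign \<sigma>) * (\<Prod>u\<in>I. M u (\<sigma> u)))"

definition conn_rel :: "'a set \<Rightarrow> ('a \<times> 'a) set \<Rightarrow> ('a \<times> 'a) set" where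
  "conn_rel V' E' = ({(u,v). u \<in> V' \<and> v \<in> V' \<and> ((u,v) \<in> E' \<or> (v,u) \<in> E')})\<^sup>*"

definition comp_classes :: "'a set \<Rightarrow> ('a \<times> 'a) set \<Rightarrow> 'a set set" where
  "comp_classes V' E' = {conn_rel V' E' `` {v} | v. v \<in> V'}"

definition comp_arcs :: "('a \<times> 'a) set \<Rightarrow> 'a set \<Rightarrow> ('a \<times> 'a) set" where
  "comp_arcs E' C = {e \<in> E'. fst e \<in> C \<or> snd e \<in> C}"

definition all_regular :: "'a set \<Rightarrow> ('a \<times> 'a) set \<Rightarrow> bool" where
  "all_regular V' E' \<longleftrightarrow> (\<forall>C \<in> comp_classes V' E'. card C = card (comp_arcs E' C))"

definition cyc_next :: "'a list \<Rightarrow> nat \<Rightarrow> 'a" where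
  "cyc_next vs i = vs ! (Suc i mod length vs)"

definition is_cycle :: "'a set \<Rightarrow> ('a \<times> 'a) set \<Rightarrow> 'a list \<Rightarrow> bool" where
  "is_cycle C F vs \<longleftrightarrow> length vs \<ge> 3 \<and> distinct vs \<and> set vs \<subseteq> C \<and>
     (\<forall>i < length vs. (vs ! i, cyc_next vs i) \<in> F \<or> (cyc_next vs i, vs ! i) \<in> F)"

definition cycle_arcs :: "('a \<times> 'a) set \<Rightarrow> 'a list \<Rightarrow> ('a \<times> 'a) set" where
  "cycle_arcs F vs = {e \<in> F. \<exists>i < length vs.
      e = (vs ! i, cyc_next vs i) \<or> e = (cyc_next vs i, vs ! i)}"

definition fwd_arcs :: "('a \<times> 'a) set \<Rightarrow> 'a list \<Rightarrow> nat" where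
  "fwd_arcs F vs = card {i. i < length vs \<and> (vs ! i, cyc_next vs i) \<in> F}"

definition bwd_arcs :: "('a \<times> 'a) set \<Rightarrow> 'a list \<Rightarrow> nat" where
  "bwd_arcs F vs = card {i. i < length vs \<and> (cyc_next vs i, vs ! i) \<in> F}"

text \<open>Number g of negative arcs for the traversal direction with 0 \<le> g \<le> k div 2.\<close>
definition neg_count :: "('a \<times> 'a) set \<Rightarrow> 'a list \<Rightarrow> nat" where
  "neg_count F vs = min (fwd_arcs F vs) (bwd_arcs F vs)"

text \<open>Unicyclic component: all arcs have both ends in C, the underlying graph
  (connected, being a component) has exactly one cycle (as an arc set).\<close>
definition unicyclic_comp :: "('a \<times> 'a) set \<Rightarrow> 'a set \<Rightarrow> bool" where
  "unicyclic_comp E' C \<longleftrightarrow>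
     (\<forall>e \<in> comp_arcs E' C. fst e \<in> C \<and> snd e \<in> C) \<and>
     (\<exists>!A. \<exists>vs. is_cycle C (comp_arcs E' C) vs \<and> A = cycle_arcs (comp_arcs E' C) vs)"

definition p_vanishing :: "nat \<Rightarrow> ('a \<times> 'a) set \<Rightarrow> 'a set \<Rightarrow> bool" where
  "p_vanishing p E' C \<longleftrightarrow> unicyclic_comp E' C \<and>
     (\<exists>vs. is_cycle C (comp_arcs E' C) vs \<and>
        p dvd (length vs - 2 * neg_count (comp_arcs E' C) vs))"

definition omega_pq :: "nat \<Rightarrow> nat \<Rightarrow> complex" where
  "omega_pq p q = cis (2 * pi * real q / real p)"

end

theory Submission
  imports Defs "Jordan_Normal_Form.Determinant" "HOL-Number_Theory.Cong"
begin

text \<open>The Laplacian is block diagonal over the components. In a component with as many arcs as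
  vertices, a vertex of degree one can be deleted together with its arc without changing the
  determinant (pivot on its diagonal entry \<open>1\<close>) or the cycles. If one arc leaves the component this
  ends with a single vertex of degree one and determinant \<open>1\<close>. Otherwise it ends with a cycle, whose
  Laplacian factors as \<open>B\<^sup>* B\<close> with \<open>B\<close> cyclic bidiagonal, so that its determinant is
  \<open>|1 - \<omega> ^ (k - 2 g)|\<^sup>2\<close>. For \<open>p\<close> not dividing \<open>m\<close>, the numbers \<open>|1 - \<omega>\<^sub>q ^ m|\<^sup>2\<close> with
  \<open>q \<le> (p - 1) / 2\<close> multiply to the product of \<open>1 - \<zeta>\<close> over all \<open>p\<close>-th roots of unity \<open>\<zeta> \<noteq> 1\<close>,
  which is the value \<open>p\<close> of \<open>1 + X + \<dots> + X ^ (p - 1)\<close> at \<open>1\<close>.\<close>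

subsection \<open>Determinants\<close>

text \<open>Enumerating the index set by \<open>xs\<close> carries the permutations of
  \<open>{0..<length xs}\<close> bijectively and with their signs to those of \<open>set xs\<close>.
  This makes the matrix theory available for \<open>det_on\<close>.\<close>

lemma det_on_conv_det:
  assumes "distinct xs"
  shows "det_on (set xs) M =
    Determinant.det (mat (length xs) (length xs) (\<lambda>(i, j). M (xs ! i) (xs ! j)))"
proof -
  let ?n = "length xs" and ?f = "(!) xs"
  have inj: "inj_on ?f {0..<?n}"
    using assms by (auto simp: inj_on_def nth_eq_iff_index_eq)
  have img: "?f ` {0..<?n} = set xs"
    by (auto simp: set_conv_nth)
  have bij: "bij_betw ?f {0..<?n} (set xs)"
    using inj img by (simp add: bij_betw_def)
  let ?g = "inv_into {0..<?n} ?f"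
  have bij': "bij_betw ?g (set xs) {0..<?n}"
    using bij by (rule bij_betw_inv_into)
  have "bij_betw (map_permutation {0..<?n} ?f) {p. p permutes {0..<?n}} {p. p permutes set xs}"
  proof (rule bij_betw_byWitness[where f' = "map_permutation (set xs) ?g"])
    show "\<forall>p\<in>{p. p permutes {0..<?n}}.
        map_permutation (set xs) ?g (map_permutation {0..<?n} ?f p) = p"
    proof
      fix p assume "p \<in> {p. p permutes {0..<?n}}"
      then show "map_permutation (set xs) ?g (map_permutation {0..<?n} ?f p) = p"
        by (intro map_permutation_compose_inv[OF bij]) (auto simp: inj inv_into_f_f)
    qed
    show "\<forall>p\<in>{p. p permutes set xs}.
        map_permutation {0..<?n} ?f (map_permutation (set xs) ?g p) = p"
    proof
      fix p assume "p \<in> {p. p permutes set xs}"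
      then show "map_permutation {0..<?n} ?f (map_permutation (set xs) ?g p) = p"
        by (intro map_permutation_compose_inv[OF bij']) (auto simp: img f_inv_into_f)
    qed
  qed (auto intro: map_permutation_permutes bij bij')
  then have "det_on (set xs) M = (\<Sum>p | p permutes {0..<?n}.
      of_int (sign (map_permutation {0..<?n} ?f p)) *
      (\<Prod>u\<in>set xs. M u (map_permutation {0..<?n} ?f p u)))"
    unfolding det_on_def by (rule sum.reindex_bij_betw[symmetric])
  also have "\<dots> = (\<Sum>p | p permutes {0..<?n}. of_int (sign p) *
      (\<Prod>i = 0..<?n. M (xs ! i) (xs ! p i)))"
  proof (rule sum.cong[OF refl])
    fix p assume "p \<in> {p. p permutes {0..<?n}}"
    then have p: "p permutes {0..<?n}" by simp
    have "(\<Prod>u\<in>set xs. M u (map_permutation {0..<?n} ?f p u)) =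
        (\<Prod>i = 0..<?n. M (xs ! i) (map_permutation {0..<?n} ?f p (xs ! i)))"
      by (rule prod.reindex_bij_betw[OF bij, symmetric])
    also have "\<dots> = (\<Prod>i = 0..<?n. M (xs ! i) (xs ! p i))"
      by (rule prod.cong) (auto simp: map_permutation_apply[OF inj])
    finally show "of_int (sign (map_permutation {0..<?n} ?f p)) *
        (\<Prod>u\<in>set xs. M u (map_permutation {0..<?n} ?f p u)) =
        of_int (sign p) * (\<Prod>i = 0..<?n. M (xs ! i) (xs ! p i))"
      by (simp add: sign_map_permutation[OF inj p])
  qed
  also have "\<dots> = Determinant.det (mat ?n ?n (\<lambda>(i, j). M (xs ! i) (xs ! j)))"
    by (subst det_def'[of _ ?n])
      (auto intro!: sum.cong prod.cong arg_cong2[where f = "(*)"] simp: permutes_in_image)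
  finally show ?thesis .
qed

lemma det_on_empty [simp]: "det_on {} M = 1"
  by (simp add: det_on_def)

lemma det_on_cong:
  assumes "\<And>u v. u \<in> I \<Longrightarrow> v \<in> I \<Longrightarrow> M u v = N u v"
  shows "det_on I M = det_on I N"
  unfolding det_on_def
  by (intro sum.cong prod.cong arg_cong2[where f = "(*)"]) (auto simp: permutes_in_image assms)

text \<open>With \<open>A\<close> listed before \<open>B\<close> the matrix is block lower
  triangular, so the determinant is the product over the diagonal blocks.\<close>

lemma det_on_Un_block:
  assumes "finite A" "finite B" "A \<inter> B = {}"
    and zero: "\<And>u v. u \<in> A \<Longrightarrow> v \<in> B \<Longrightarrow> M u v = 0"
  shows "det_on (A \<union> B) M = det_on A M * det_on B M"
proof -
  obtain xs where xs: "set xs = A" "distinct xs"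
    using finite_distinct_list[OF \<open>finite A\<close>] by blast
  obtain ys where ys: "set ys = B" "distinct ys"
    using finite_distinct_list[OF \<open>finite B\<close>] by blast
  let ?n = "length xs" and ?m = "length ys"
  let ?mat = "\<lambda>as bs. mat (length as) (length bs) (\<lambda>(i, j). M (as ! i) (bs ! j))"
  have "?mat (xs @ ys) (xs @ ys) =
      four_block_mat (?mat xs xs) (0\<^sub>m ?n ?m) (?mat ys xs) (?mat ys ys)"
  proof (rule eq_matI)
    fix i j
    assume "i < dim_row (four_block_mat (?mat xs xs) (0\<^sub>m ?n ?m) (?mat ys xs) (?mat ys ys))"
      "j < dim_col (four_block_mat (?mat xs xs) (0\<^sub>m ?n ?m) (?mat ys xs) (?mat ys ys))"
    then have ij: "i < ?n + ?m" "j < ?n + ?m" by auto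
    then show "?mat (xs @ ys) (xs @ ys) $$ (i, j) =
        four_block_mat (?mat xs xs) (0\<^sub>m ?n ?m) (?mat ys xs) (?mat ys ys) $$ (i, j)"
      using xs(1) ys(1) by (auto simp: nth_append intro!: zero)
  qed auto
  then have "det_on (set (xs @ ys)) M = Determinant.det (?mat xs xs) * Determinant.det (?mat ys ys)"
    using xs ys assms(3)
    by (subst det_on_conv_det)
      (auto intro!: det_four_block_mat_upper_right_zero[where n = ?n and m = ?m])
  then show ?thesis
    using xs ys by (simp flip: det_on_conv_det)
qed

lemma det_on_Union_block:
  assumes "finite \<C>" "\<And>A. A \<in> \<C> \<Longrightarrow> finite A" "pairwise disjnt \<C>"
    and "\<And>A B u v. A \<in> \<C> \<Longrightarrow> B \<in> \<C> \<Longrightarrow> A \<noteq> B \<Longrightarrow> u \<in> A \<Longrightarrow> v \<in> B \<Longrightarrow> M u v = 0"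
  shows "det_on (\<Union>\<C>) M = (\<Prod>A\<in>\<C>. det_on A M)"
  using assms
proof (induction \<C> rule: finite_induct)
  case (insert A \<C>)
  have "det_on (A \<union> \<Union>\<C>) M = det_on A M * det_on (\<Union>\<C>) M"
  proof (rule det_on_Un_block)
    show "finite (\<Union>\<C>)" using insert by blast
    show "A \<inter> \<Union>\<C> = {}"
      using insert.hyps insert.prems(2) by (auto simp: pairwise_insert disjnt_def)
    show "M u v = 0" if "u \<in> A" "v \<in> \<Union>\<C>" for u v
      using that insert.hyps insert.prems(3) by blast
  qed (use insert in auto)
  moreover have "det_on (\<Union>\<C>) M = (\<Prod>A\<in>\<C>. det_on A M)"
  proof (rule insert.IH)
    show "M u v = 0" if "X \<in> \<C>" "Y \<in> \<C>" "X \<noteq> Y" "u \<in> X" "v \<in> Y" for X Y u v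
      using insert.prems(3)[of X Y u v] that by simp
  qed (use insert.prems in \<open>auto simp: pairwise_insert\<close>)
  ultimately show ?case
    using insert.hyps by simp
qed simp

text \<open>Schur complement with respect to the pivot 1 at \<open>u\<close>; this is how a vertex
  of degree one is eliminated.\<close>

lemma det_on_pivot:
  assumes "finite I" "u \<in> I" "M u u = 1"
  shows "det_on I M = det_on (I - {u}) (\<lambda>a b. M a b - M a u * M u b)"
proof -
  obtain xs where xs: "set xs = I - {u}" "distinct xs"
    using finite_distinct_list[of "I - {u}"] assms(1) by blast
  let ?n = "length xs"
  let ?r = "mat 1 ?n (\<lambda>(i, j). M u (xs ! j))" and ?c = "mat ?n 1 (\<lambda>(i, j). M (xs ! i) u)"
  let ?S = "mat ?n ?n (\<lambda>(i, j). M (xs ! i) (xs ! j) - M (xs ! i) u * M u (xs ! j))"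
  let ?P = "four_block_mat (1\<^sub>m 1) (0\<^sub>m 1 ?n) ?c (1\<^sub>m ?n)"
  let ?Q = "four_block_mat (1\<^sub>m 1) ?r (0\<^sub>m ?n 1) ?S"
  \<comment> \<open>With \<open>u\<close> listed first, the matrix is \<open>?P * ?Q\<close>, where
    \<open>?P\<close> is unitriangular and \<open>?Q\<close> is block upper triangular with the
    Schur complement \<open>?S\<close> in its corner.\<close>
  have "?P * ?Q = four_block_mat (1\<^sub>m 1) ?r ?c (?c * ?r + ?S)"
    by (subst mult_four_block_mat[where ?nr1.0 = 1 and ?n1.0 = 1 and ?n2.0 = ?n and ?nr2.0 = ?n
          and ?nc1.0 = 1 and ?nc2.0 = ?n]) auto
  also have "\<dots> = mat (length (u # xs)) (length (u # xs)) (\<lambda>(i, j). M ((u # xs) ! i) ((u # xs) ! j))"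
    by (rule eq_matI) (auto simp: assms(3) nth_Cons' scalar_prod_def)
  finally have "det_on (set (u # xs)) M = Determinant.det (?P * ?Q)"
    using xs by (subst det_on_conv_det) auto
  also have "\<dots> = Determinant.det ?P * Determinant.det ?Q"
    by (rule det_mult[where n = "Suc ?n"]) (auto intro: carrier_matI)
  also have "Determinant.det ?P = 1"
    by (subst det_four_block_mat_upper_right_zero[where n = 1 and m = ?n]) auto
  also have "Determinant.det ?Q = Determinant.det ?S"
    by (subst det_four_block_mat_lower_left_zero[where n = 1 and m = ?n]) auto
  also have "1 * Determinant.det ?S = det_on (set xs) (\<lambda>a b. M a b - M a u * M u b)"
    using xs(2) by (simp add: det_on_conv_det)
  finally show ?thesis
    using xs(1) assms(2) by (simp add: insert_absorb)
qed

section \<open>Cyclic bidiagonal and tridiagonal matrices\<close>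

text \<open>Column 0 has nonzero entries at most in the first and last rows. Deleting the first row
  and column leaves an upper triangular matrix with unit diagonal; deleting the last row instead
  leaves a lower triangular one with diagonal \<open>- w i\<close>, whose sign cancels against that
  of the cofactor. The bound \<open>n \<ge> 2\<close> keeps the diagonal and the cyclic
  superdiagonal apart.\<close>

lemma det_cyclic_bidiagonal:
  fixes w :: "nat \<Rightarrow> 'a :: comm_ring_1"
  assumes "n \<ge> 2"
  shows "Determinant.det (mat n n (\<lambda>(i, j). if j = i then 1 else if j = Suc i mod n then - w i else 0))
    = 1 - (\<Prod>i<n. w i)"
    (is "Determinant.det ?B = _")
proof -
  obtain m where n: "n = Suc m" and m: "m \<ge> 1"
    using assms by (cases n) auto
  have B: "?B \<in> carrier_mat n n" by simp
  have "Determinant.det ?B = (\<Sum>i<n. ?B $$ (i, 0) * cofactor ?B i 0)"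
    using assms by (intro laplace_expansion_column[OF B]) auto
  also have "\<dots> = (\<Sum>i\<in>{0, m}. ?B $$ (i, 0) * cofactor ?B i 0)"
    by (rule sum.mono_neutral_right) (auto simp: n)
  also have "\<dots> = cofactor ?B 0 0 - w m * cofactor ?B m 0"
    using m by (simp add: n)
  also have "cofactor ?B 0 0 = 1"
  proof -
    let ?D = "mat_delete ?B 0 0"
    have D: "?D \<in> carrier_mat m m" using n by (auto simp: mat_delete_def)
    have "Determinant.det ?D = prod_list (diag_mat ?D)"
      by (rule det_upper_triangular[OF _ D])
        (auto simp: mat_delete_def n mod_Suc split: if_splits intro!: upper_triangularI)
    also have "\<dots> = 1"
      unfolding prod_list_diag_prod by (rule prod.neutral) (auto simp: mat_delete_def n)
    finally show ?thesis by (simp add: cofactor_def)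
  qed
  also have "cofactor ?B m 0 = (\<Prod>i<m. w i)"
  proof -
    let ?D = "mat_delete ?B m 0"
    have D: "?D \<in> carrier_mat m m" using n by (auto simp: mat_delete_def)
    have "Determinant.det ?D = prod_list (diag_mat ?D)"
      by (rule det_lower_triangular[OF _ D]) (auto simp: mat_delete_def n)
    also have "\<dots> = (\<Prod>i<m. - w i)"
      unfolding prod_list_diag_prod
      by (rule prod.cong) (auto simp: mat_delete_def n)
    also have "\<dots> = (-1) ^ m * (\<Prod>i<m. w i)"
      using prod.distrib[of "\<lambda>_. -1 :: 'a" w "{..<m}"] by simp
    finally show ?thesis
      by (simp add: cofactor_def mult.assoc[symmetric] flip: power_add)
  qed
  finally show ?thesis
    by (simp add: n mult.commute)
qed

text \<open>The matrix is the conjugate transpose of the bidiagonal matrix \<open>B w\<close> times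
  \<open>B w\<close>. Each column of \<open>B w\<close> holds a 1 and one entry of modulus 1, which
  gives the diagonal entry 2; for \<open>n \<ge> 3\<close> the cyclic successor and predecessor of
  an index differ.\<close>

lemma det_cyclic_tridiagonal:
  fixes w :: "nat \<Rightarrow> complex"
  assumes "n \<ge> 3" and w: "\<And>i. cmod (w i) = 1"
  shows "Determinant.det (mat n n (\<lambda>(i, j). if i = j then 2 else if j = Suc i mod n then - w i
      else if i = Suc j mod n then - cnj (w j) else 0))
    = (1 - (\<Prod>i<n. w i)) * (1 - cnj (\<Prod>i<n. w i))"
    (is "Determinant.det ?L = _")
proof -
  define B where "B w = mat n n (\<lambda>(i, j). if j = i then 1 else if j = Suc i mod n then - w i else 0)"
    for w :: "nat \<Rightarrow> complex"
  have B: "B w \<in> carrier_mat n n" for w by (simp add: B_def)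
  have detB: "Determinant.det (B w) = 1 - (\<Prod>i<n. w i)" for w
    unfolding B_def by (rule det_cyclic_bidiagonal) (use assms in simp)
  have "?L = transpose_mat (B (\<lambda>i. cnj (w i))) * B w"
  proof (rule eq_matI)
    fix i j
    assume "i < dim_row (transpose_mat (B (\<lambda>i. cnj (w i))) * B w)"
      "j < dim_col (transpose_mat (B (\<lambda>i. cnj (w i))) * B w)"
    then have i: "i < n" and j: "j < n" by (auto simp: B_def)
    \<comment> \<open>\<open>k\<close> is the cyclic predecessor of \<open>i\<close>, the only row
      besides \<open>i\<close> where column \<open>i\<close> of \<open>B w\<close> is
      nonzero.\<close>
    define k where "k = (if i = 0 then n - 1 else i - 1)"
    have k: "k < n" "k \<noteq> i" and Suc_k: "\<And>l. l < n \<Longrightarrow> i = Suc l mod n \<longleftrightarrow> l = k"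
      using i assms(1) by (auto simp: k_def mod_Suc split: if_splits)
    have "(transpose_mat (B (\<lambda>i. cnj (w i))) * B w) $$ (i, j) =
        (\<Sum>l\<in>{0..<n}. B (\<lambda>i. cnj (w i)) $$ (l, i) * B w $$ (l, j))"
      using i j by (simp add: scalar_prod_def B_def)
    also have "\<dots> = (\<Sum>l\<in>{i, k}. B (\<lambda>i. cnj (w i)) $$ (l, i) * B w $$ (l, j))"
      using i k by (intro sum.mono_neutral_right) (auto simp: B_def Suc_k)
    also have "\<dots> = B w $$ (i, j) - cnj (w k) * B w $$ (k, j)"
      using i k by (simp add: B_def Suc_k)
    also have "\<dots> = ?L $$ (i, j)"
    proof -
      have ww: "cnj (w k) * w k = 1"
        using w[of k] by (metis complex_norm_square mult.commute of_real_1 power_one)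
      have Sk: "Suc k mod n = i" using Suc_k[of k] k by simp
      have "Suc i mod n \<noteq> k" "Suc i mod n \<noteq> i"
        using i assms(1) by (auto simp: k_def mod_Suc split: if_splits)
      then show ?thesis
        using i j k ww Sk by (auto simp: B_def Suc_k)
    qed
    finally show "?L $$ (i, j) = (transpose_mat (B (\<lambda>i. cnj (w i))) * B w) $$ (i, j)" ..
  qed (auto simp: B_def)
  then have "Determinant.det ?L = Determinant.det (B (\<lambda>i. cnj (w i))) * Determinant.det (B w)"
    using B by (simp add: det_mult[where n = n] det_transpose[where n = n])
  then show ?thesis
    by (simp add: detB mult.commute)
qed

subsection \<open>Roots of unity\<close>

text \<open>Since \<open>m\<close> is invertible modulo \<open>p\<close>, the points
  \<open>r q\<close> for 0 < q < p are all the nontrivial \<open>p\<close>-th roots of unity, hence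
  the roots of 1 + X + ... + X^(p-1). Its factorisation is evaluated at 1.\<close>

lemma prod_one_minus_roots_of_unity:
  fixes p m :: nat
  assumes "prime p" "\<not> p dvd m"
  shows "(\<Prod>q = 1..<p. 1 - cis (2 * pi * real (q * m) / real p)) = of_nat p"
proof -
  define r where "r q = cis (2 * pi * real (q * m) / real p)" for q
  have p: "p > 0" using assms(1) by (simp add: prime_gt_0_nat)
  have r_exp: "r q = exp (2 * of_real pi * \<i> * of_nat (q * m) / of_nat p)" for q
    by (simp add: r_def cis_conv_exp mult_ac)
  have r_eq: "r a = r b \<longleftrightarrow> (a * m) mod p = (b * m) mod p" for a b
    unfolding r_exp using p by (subst complex_root_unity_eq) auto
  have "coprime m p"
    using assms by (metis coprime_commute prime_imp_coprime)
  then have cancel: "(a * m) mod p = (b * m) mod p \<longleftrightarrow> a mod p = b mod p" for a b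
    using cong_mult_rcancel_nat[of m p a b] by (simp add: cong_def)
  have inj: "inj_on r {0..<p}"
    by (auto simp: inj_on_def r_eq cancel)
  have r_root: "(\<Sum>i<p. r q ^ i) = 0" if "q \<in> {1..<p}" for q
  proof -
    have "r q \<noteq> r 0" using inj that p unfolding inj_on_def by force
    then have "r q \<noteq> 1" by (simp add: r_def)
    moreover have "r q ^ p = 1"
    proof -
      have "r q ^ p = cis (2 * pi * real (q * m))"
        using p by (simp add: r_def Complex.DeMoivre)
      then show ?thesis by (simp add: cis_multiple_2pi)
    qed
    ultimately show ?thesis by (simp add: geometric_sum)
  qed
  let ?P = "\<Sum>i<p. monom 1 i :: complex poly" and ?Q = "\<Prod>q = 1..<p. [:- r q, 1:]"
  \<comment> \<open>Both polynomials have degree at most \<open>p - 1\<close> and the same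
    coefficient there, so agreement at \<open>p - 1\<close> distinct points suffices.\<close>
  have "?P = ?Q"
  proof (rule poly_eqI_degree_lead_coeff[where n = "p - 1" and A = "r ` {1..<p}"])
    have deg: "degree ?Q = p - 1"
      by (subst degree_prod_eq_sum_degree) auto
    then show "degree ?Q \<le> p - 1" by simp
    have "lead_coeff ?Q = 1" by (simp add: lead_coeff_prod)
    then show "poly.coeff ?P (p - 1) = poly.coeff ?Q (p - 1)"
      using deg p by (simp add: coeff_sum)
    show "degree ?P \<le> p - 1"
      by (rule degree_sum_le) (auto intro: order.trans[OF degree_monom_le])
    show "p - 1 \<le> card (r ` {1..<p})"
      using inj by (subst card_image) (auto intro: inj_on_subset)
    show "poly ?P z = poly ?Q z" if "z \<in> r ` {1..<p}" for z
    proof -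
      have "poly ?P z = 0"
        using that r_root by (auto simp: poly_sum poly_monom)
      moreover have "poly ?Q z = 0"
        using that by (auto simp: poly_prod intro!: prod_zero)
      ultimately show ?thesis by simp
    qed
  qed
  then have "poly ?P 1 = poly ?Q 1" by simp
  then show ?thesis
    by (simp add: poly_sum poly_monom poly_prod r_def)
qed

text \<open>Conjugation exchanges the roots of unity with indices \<open>q\<close> and
  \<open>p - q\<close>, so the conjugate factors supply the missing upper half of the product over 0
  < q < p.\<close>

lemma prod_norm_square_one_minus_omega:
  fixes p m :: nat
  assumes "prime p" "odd p" "\<not> p dvd m"
  shows "(\<Prod>q = 1..(p - 1) div 2. (1 - omega_pq p q ^ m) * (1 - cnj (omega_pq p q) ^ m)) = of_nat p"
proof -
  define h where "h = (p - 1) div 2"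
  have p: "p = 2 * h + 1" using assms(2) by (auto simp: h_def elim!: oddE)
  define r where "r q = cis (2 * pi * real (q * m) / real p)" for q
  have omega: "omega_pq p q ^ m = r q" for q
    by (simp add: omega_pq_def r_def Complex.DeMoivre mult_ac)
  have cnj_r: "cnj (r q) = r (p - q)" if "q \<le> p" for q
  proof -
    have "r q * r (p - q) = cis (2 * pi * (real q * real m / real p + (real p - real q) * real m / real p))"
      using that by (simp add: r_def cis_mult of_nat_diff algebra_simps)
    also have "real q * real m / real p + (real p - real q) * real m / real p = real m"
      using odd_pos[OF assms(2)] by (simp add: field_simps)
    also have "cis (2 * pi * real m) = 1"
      by (simp add: cis_multiple_2pi)
    finally have "r (p - q) = inverse (r q)"
      by (metis inverse_unique)
    then show ?thesis by (simp add: r_def cis_cnj cis_inverse)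
  qed
  have omega': "cnj (omega_pq p q) ^ m = r (p - q)" if "q \<le> p" for q
    using cnj_r[OF that] by (simp flip: omega)
  have "(\<Prod>q = 1..h. (1 - omega_pq p q ^ m) * (1 - cnj (omega_pq p q) ^ m)) =
      (\<Prod>q = 1..h. 1 - r q) * (\<Prod>q = 1..h. 1 - r (p - q))"
    unfolding prod.distrib[symmetric]
  proof (rule prod.cong[OF refl])
    fix q assume "q \<in> {1..h}"
    then have "q \<le> p" by (simp add: p)
    then show "(1 - omega_pq p q ^ m) * (1 - cnj (omega_pq p q) ^ m) = (1 - r q) * (1 - r (p - q))"
      by (simp add: omega omega')
  qed
  \<comment> \<open>As \<open>p = 2 * h + 1\<close>, the reflection of \<open>q\<close> to
    \<open>p - q\<close> maps 1..h onto h+1..p-1.\<close>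
  also have "(\<Prod>q = 1..h. 1 - r (p - q)) = (\<Prod>q = h + 1..<p. 1 - r q)"
    by (rule prod.reindex_bij_witness[where i = "\<lambda>q. p - q" and j = "\<lambda>q. p - q"]) (auto simp: p)
  also have "(\<Prod>q = 1..h. 1 - r q) * \<dots> = (\<Prod>q = 1..<p. 1 - r q)"
  proof -
    have "{1..<p} = {1..h} \<union> {h + 1..<p}" "{1..h} \<inter> {h + 1..<p} = {}" using p by auto
    then show ?thesis by (metis prod.union_disjoint finite_atLeastAtMost finite_atLeastLessThan)
  qed
  also have "\<dots> = of_nat p"
    unfolding r_def by (rule prod_one_minus_roots_of_unity[OF assms(1,3)])
  finally show ?thesis by (simp add: h_def)
qed

subsection \<open>Components with as many arcs as vertices\<close>

definition nbhd :: "('a \<times> 'a) set \<Rightarrow> 'a \<Rightarrow> 'a set" where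
  "nbhd F u = {v. (u, v) \<in> F \<or> (v, u) \<in> F}"

definition oriented_arcs :: "('a \<times> 'a) set \<Rightarrow> bool" where
  "oriented_arcs F \<longleftrightarrow> (\<forall>(u, v)\<in>F. u \<noteq> v \<and> (v, u) \<notin> F)"

text \<open>This condition separates the two kinds of components: those with determinant 1, and the
  unicyclic ones.\<close>

definition internal_arcs :: "'a set \<Rightarrow> ('a \<times> 'a) set \<Rightarrow> bool" where
  "internal_arcs C F \<longleftrightarrow> (\<forall>e\<in>F. fst e \<in> C \<and> snd e \<in> C)"

text \<open>Connectedness, phrased by neighbour-closed subsets instead of paths, which makes it easy
  to carry through the deletion of a vertex. Neighbours are intersected with \<open>C\<close>
  because arcs may leave \<open>C\<close>.\<close>

definition indecomposable :: "'a set \<Rightarrow> ('a \<times> 'a) set \<Rightarrow> bool" where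
  "indecomposable C F \<longleftrightarrow>
    (\<forall>S\<subseteq>C. S \<noteq> {} \<longrightarrow> (\<forall>u\<in>S. nbhd F u \<inter> C \<subseteq> S) \<longrightarrow> S = C)"

definition two_regular :: "'a set \<Rightarrow> ('a \<times> 'a) set \<Rightarrow> bool" where
  "two_regular C F \<longleftrightarrow> (\<forall>u\<in>C. card (nbhd F u) = 2)"

lemma nbhd_sym: "v \<in> nbhd F u \<longleftrightarrow> u \<in> nbhd F v"
  by (auto simp: nbhd_def)

lemma nbhd_irrefl: "oriented_arcs F \<Longrightarrow> u \<notin> nbhd F u"
  by (auto simp: nbhd_def oriented_arcs_def)

lemma finite_nbhd: "finite F \<Longrightarrow> finite (nbhd F u)"
  by (rule finite_subset[of _ "fst ` F \<union> snd ` F"]) (force simp: nbhd_def)+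

lemma nbhd_subset_internal: "internal_arcs C F \<Longrightarrow> nbhd F u \<subseteq> C"
  by (auto simp: nbhd_def internal_arcs_def)

lemma oriented_arcs_mono: "oriented_arcs F \<Longrightarrow> F' \<subseteq> F \<Longrightarrow> oriented_arcs F'"
  unfolding oriented_arcs_def by blast

lemma oriented_arcs_asym: "oriented_arcs F \<Longrightarrow> (u, v) \<in> F \<Longrightarrow> (v, u) \<notin> F"
  by (auto simp: oriented_arcs_def)

text \<open>Sending an arc at \<open>u\<close> to its other end is injective, because opposite arcs
  are excluded.\<close>

lemma arc_degree_eq_card_nbhd:
  assumes "oriented_arcs F"
  shows "arc_degree F u = card (nbhd F u)"
  unfolding arc_degree_def
proof (rule bij_betw_same_card)
  show "bij_betw (\<lambda>e. if fst e = u then snd e else fst e) {e \<in> F. fst e = u \<or> snd e = u} (nbhd F u)"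
    unfolding bij_betw_def
  proof
    show "inj_on (\<lambda>e. if fst e = u then snd e else fst e) {e \<in> F. fst e = u \<or> snd e = u}"
      by (auto simp: inj_on_def dest: oriented_arcs_asym[OF assms])
    show "(\<lambda>e. if fst e = u then snd e else fst e) ` {e \<in> F. fst e = u \<or> snd e = u} = nbhd F u"
    proof (intro equalityI subsetI)
      fix v assume "v \<in> nbhd F u"
      then consider "(u, v) \<in> F" | "(v, u) \<in> F" "v \<noteq> u"
        using assms by (auto simp: nbhd_def oriented_arcs_def)
      then show "v \<in> (\<lambda>e. if fst e = u then snd e else fst e) ` {e \<in> F. fst e = u \<or> snd e = u}"
        by cases (auto intro: rev_image_eqI)
    qed (auto simp: nbhd_def)
  qed
qed

text \<open>Double counting of incidences; an arc that leaves \<open>C\<close> is counted only at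
  its end in \<open>C\<close>.\<close>

lemma sum_arc_degree:
  assumes "finite C" "finite F"
  shows "(\<Sum>u\<in>C. arc_degree F u) = (\<Sum>e\<in>F. card ({fst e, snd e} \<inter> C))"
proof -
  have "(\<Sum>u\<in>C. arc_degree F u) = (\<Sum>u\<in>C. \<Sum>e\<in>F. if u \<in> {fst e, snd e} then 1 else 0)"
  proof (rule sum.cong[OF refl])
    fix u
    have "arc_degree F u = card (F \<inter> {e. u \<in> {fst e, snd e}})"
      unfolding arc_degree_def by (rule arg_cong[where f = card]) auto
    then show "arc_degree F u = (\<Sum>e\<in>F. if u \<in> {fst e, snd e} then 1 else 0)"
      using assms(2) by (simp add: sum.If_cases del: insert_iff)
  qed
  also have "\<dots> = (\<Sum>e\<in>F. \<Sum>u\<in>C. if u \<in> {fst e, snd e} then 1 else 0)"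
    by (rule sum.swap)
  also have "\<dots> = (\<Sum>e\<in>F. card ({fst e, snd e} \<inter> C))"
    using assms(1) by (simp add: sum.If_cases Int_commute del: insert_iff)
  finally show ?thesis .
qed

text \<open>The invariant of the induction: these properties pass from a component to what remains
  after deleting a vertex of degree one whose neighbour lies in \<open>C\<close>.\<close>

locale regular_component =
  fixes C :: "'a set" and F :: "('a \<times> 'a) set"
  assumes finite_C: "finite C" and finite_F: "finite F" and C_nonempty: "C \<noteq> {}"
    and oriented: "oriented_arcs F"
    and touching: "\<And>e. e \<in> F \<Longrightarrow> fst e \<in> C \<or> snd e \<in> C"
    and card_eq: "card C = card F"
    and indec: "indecomposable C F"
begin

text \<open>An isolated vertex would be all of \<open>C\<close> by indecomposability; then no arc
  could touch \<open>C\<close>, although there are as many arcs as vertices.\<close>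

lemma arc_degree_pos:
  assumes "u \<in> C"
  shows "arc_degree F u > 0"
proof (rule ccontr)
  assume "\<not> arc_degree F u > 0"
  then have "{e \<in> F. fst e = u \<or> snd e = u} = {}"
    using finite_F by (simp add: arc_degree_def)
  then have no_arc: "fst e \<noteq> u \<and> snd e \<noteq> u" if "e \<in> F" for e
    using that by blast
  then have "nbhd F u = {}"
    by (force simp: nbhd_def)
  then have "C = {u}"
    using indec assms unfolding indecomposable_def by (metis Int_empty_left empty_subsetI
        insert_not_empty insert_subset singletonD)
  then have "F = {}"
    using touching no_arc by fastforce
  with card_eq \<open>C = {u}\<close> show False by simp
qed

text \<open>Without vertices of degree one the degree sum is at least \<open>2 |C| = 2 |F|\<close>, whereas each arc
  contributes at most two to it, so both bounds are attained.\<close>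
lemma leafless_two_regular:
  assumes "\<And>u. u \<in> C \<Longrightarrow> arc_degree F u \<noteq> 1"
  shows "two_regular C F" "internal_arcs C F"
proof -
  have ge: "2 \<le> arc_degree F u" if "u \<in> C" for u
    using assms[OF that] arc_degree_pos[OF that] by linarith
  have le: "card ({fst e, snd e} \<inter> C) \<le> 2" for e
    by (rule order.trans[OF card_mono[of "{fst e, snd e}"]]) (auto simp: card_insert_if)
  have deg: "(\<Sum>u\<in>C. arc_degree F u) = (\<Sum>e\<in>F. card ({fst e, snd e} \<inter> C))"
    by (rule sum_arc_degree[OF finite_C finite_F])
  have lower: "(\<Sum>u\<in>C. 2) \<le> (\<Sum>u\<in>C. arc_degree F u)"
    by (rule sum_mono) (rule ge)
  have upper: "(\<Sum>e\<in>F. card ({fst e, snd e} \<inter> C)) \<le> (\<Sum>e\<in>F. 2)"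
    by (rule sum_mono) (rule le)
  have eqs: "(\<Sum>u\<in>C. 2) = (\<Sum>u\<in>C. arc_degree F u)"
    "(\<Sum>e\<in>F. card ({fst e, snd e} \<inter> C)) = (\<Sum>e\<in>F. 2)"
    using deg lower upper card_eq by simp_all
  have "arc_degree F u = 2" if "u \<in> C" for u
    using sum_mono_inv[OF eqs(1) ge that finite_C] by simp
  then show "two_regular C F"
    by (simp add: two_regular_def arc_degree_eq_card_nbhd[OF oriented])
  show "internal_arcs C F"
    unfolding internal_arcs_def
  proof
    fix e assume e: "e \<in> F"
    have "card ({fst e, snd e} \<inter> C) = 2"
      using sum_mono_inv[OF eqs(2) le e finite_F] .
    moreover have "card ({fst e, snd e} \<inter> C) \<le> card {x}" if "{fst e, snd e} \<inter> C \<subseteq> {x}" for x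
      using that by (rule card_mono[rotated]) simp
    ultimately show "fst e \<in> C \<and> snd e \<in> C"
      by fastforce
  qed
qed

end

section \<open>Cycles and graphs in which every vertex has two neighbours\<close>

lemma cyc_next_nth:
  assumes "i < length vs"
  shows "cyc_next vs i = (if Suc i = length vs then vs ! 0 else vs ! Suc i)"
  using assms by (auto simp: cyc_next_def)

text \<open>The inverse of the map from \<open>i\<close> to \<open>Suc i mod n\<close> on indices
  below \<open>n\<close>; index 0 is separate since natural subtraction truncates.\<close>

definition cyc_pred :: "nat \<Rightarrow> nat \<Rightarrow> nat" where
  "cyc_pred n i = (if i = 0 then n - 1 else i - 1)"

lemma cyc_pred_less: "i < n \<Longrightarrow> cyc_pred n i < n"
  by (auto simp: cyc_pred_def)

lemma eq_Suc_mod_iff_cyc_pred: "i < n \<Longrightarrow> j < n \<Longrightarrow> i = Suc j mod n \<longleftrightarrow> j = cyc_pred n i"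
  by (auto simp: cyc_pred_def mod_Suc split: if_splits)

lemma cyc_next_cyc_pred: "i < length vs \<Longrightarrow> cyc_next vs (cyc_pred (length vs) i) = vs ! i"
  using eq_Suc_mod_iff_cyc_pred[of i "length vs" "cyc_pred (length vs) i"]
  by (simp add: cyc_next_def cyc_pred_less)

text \<open>Because a cycle has length at least 3, the successor and the predecessor of a vertex on
  it are two different neighbours.\<close>

lemma is_cycle_nbhd:
  assumes "is_cycle C F vs" "i < length vs"
  shows "{cyc_next vs i, vs ! cyc_pred (length vs) i} \<subseteq> nbhd F (vs ! i)"
    and "card {cyc_next vs i, vs ! cyc_pred (length vs) i} = 2"
proof -
  let ?k = "cyc_pred (length vs) i"
  have adj: "cyc_next vs j \<in> nbhd F (vs ! j)" if "j < length vs" for j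
    using assms(1) that by (auto simp: is_cycle_def nbhd_def)
  show "{cyc_next vs i, vs ! ?k} \<subseteq> nbhd F (vs ! i)"
    using adj[OF assms(2)] adj[OF cyc_pred_less[OF assms(2)]]
    by (simp add: cyc_next_cyc_pred[OF assms(2)] nbhd_sym)
  have len: "length vs \<ge> 3" and dist: "distinct vs"
    using assms(1) by (auto simp: is_cycle_def)
  have "Suc i mod length vs \<noteq> ?k"
    using len assms(2) by (auto simp: cyc_pred_def mod_Suc split: if_splits)
  moreover have "Suc i mod length vs < length vs"
    using assms(2) by (intro mod_less_divisor) linarith
  ultimately have "cyc_next vs i \<noteq> vs ! ?k"
    using dist cyc_pred_less[OF assms(2)] by (simp add: cyc_next_def nth_eq_iff_index_eq)
  then show "card {cyc_next vs i, vs ! ?k} = 2" by simp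
qed

lemma is_cycle_card_nbhd:
  assumes "is_cycle C F vs" "finite F" "u \<in> set vs"
  shows "card (nbhd F u) \<ge> 2"
proof -
  obtain i where i: "i < length vs" "u = vs ! i"
    using assms(3) by (auto simp: in_set_conv_nth)
  show ?thesis
    using is_cycle_nbhd[OF assms(1) i(1)] card_mono[OF finite_nbhd[OF assms(2)]]
    by (metis i(2))
qed

lemma is_cycle_nbhd_two_regular:
  assumes "is_cycle C F vs" "finite F" "two_regular C F" "i < length vs"
  shows "nbhd F (vs ! i) = {cyc_next vs i, vs ! cyc_pred (length vs) i}"
proof -
  have "vs ! i \<in> C"
    using assms(1,4) by (auto simp: is_cycle_def)
  then have "card (nbhd F (vs ! i)) = 2"
    using assms(3) by (simp add: two_regular_def)
  then show ?thesis
    using is_cycle_nbhd[OF assms(1,4)] finite_nbhd[OF assms(2)]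
    by (metis card_subset_eq)
qed

text \<open>Every vertex of the cycle has both its neighbours on the cycle, so the cycle's vertex
  set is closed and equals \<open>C\<close>. Each arc then joins consecutive vertices. In particular
  all cycles have the same arc set \<open>F\<close>.\<close>

lemma two_regular_cycle_covers:
  assumes cyc: "is_cycle C F vs" and "finite F" "two_regular C F" "indecomposable C F"
    and int: "internal_arcs C F"
  shows "set vs = C" "cycle_arcs F vs = F"
proof -
  note nb = is_cycle_nbhd_two_regular[OF cyc assms(2,3)]
  have len: "length vs \<ge> 3" and sub: "set vs \<subseteq> C"
    using cyc by (auto simp: is_cycle_def)
  have next_in: "cyc_next vs i \<in> set vs" if "i < length vs" for i
    using that len unfolding cyc_next_def by (intro nth_mem mod_less_divisor) linarith
  have "nbhd F u \<subseteq> set vs" if u: "u \<in> set vs" for u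
  proof -
    obtain i where "i < length vs" "u = vs ! i"
      using u by (auto simp: in_set_conv_nth)
    then show ?thesis
      using nb[of i] next_in[of i] cyc_pred_less[of i "length vs"] by simp
  qed
  then show set_vs: "set vs = C"
    using assms(4) sub len unfolding indecomposable_def
    by (metis le_infI1 list.size(3) not_numeral_le_zero set_empty)
  show "cycle_arcs F vs = F"
  proof
    show "F \<subseteq> cycle_arcs F vs"
    proof
      fix e assume e: "e \<in> F"
      obtain a b where ab: "e = (a, b)" by (cases e)
      then have "a \<in> set vs" "b \<in> nbhd F a"
        using e int set_vs by (auto simp: internal_arcs_def nbhd_def)
      then obtain i where i: "i < length vs" "a = vs ! i" "b \<in> nbhd F (vs ! i)"
        by (auto simp: in_set_conv_nth)
      consider "b = cyc_next vs i" | "b = vs ! cyc_pred (length vs) i"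
        using i(3) nb[OF i(1)] by auto
      then show "e \<in> cycle_arcs F vs"
      proof cases
        case 1
        then show ?thesis using e ab i by (auto simp: cycle_arcs_def)
      next
        case 2
        \<comment> \<open>An arc to the predecessor is the cycle arc at the predecessor's index,
          traversed backwards.\<close>
        then have "e = (cyc_next vs (cyc_pred (length vs) i), vs ! cyc_pred (length vs) i)"
          using ab i by (simp add: cyc_next_cyc_pred)
        then show ?thesis
          using e cyc_pred_less[OF i(1)] unfolding cycle_arcs_def by blast
      qed
    qed
  qed (auto simp: cycle_arcs_def)
qed

text \<open>A longest path closes up: its first vertex has both neighbours on the path, and the second one
  can only be the last vertex, as inner vertices already have two neighbours on the path.\<close>
lemma two_regular_has_cycle:
  assumes "finite C" "C \<noteq> {}" "finite F" "oriented_arcs F" "internal_arcs C F"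
    and reg: "two_regular C F"
  shows "\<exists>vs. is_cycle C F vs"
proof -
  define path where "path xs \<longleftrightarrow> distinct xs \<and> set xs \<subseteq> C \<and> xs \<noteq> [] \<and>
    (\<forall>i. Suc i < length xs \<longrightarrow> xs ! Suc i \<in> nbhd F (xs ! i))" for xs
  obtain c where "c \<in> C" using assms(2) by blast
  then have "path [c]" by (simp add: path_def)
  moreover have "\<forall>xs. path xs \<longrightarrow> length xs < Suc (card C)"
    using assms(1) by (metis path_def card_mono distinct_card less_Suc_eq_le)
  ultimately have "\<exists>xs. path xs \<and> (\<forall>ys. path ys \<longrightarrow> length ys \<le> length xs)"
    by (rule ex_has_greatest_nat)
  then obtain xs where xs: "path xs" and longest: "\<And>ys. path ys \<Longrightarrow> length ys \<le> length xs"
    by auto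
  define n where "n = length xs"
  have dist: "distinct xs" and sub: "set xs \<subseteq> C" and ne: "xs \<noteq> []"
    and adj: "\<And>i. Suc i < n \<Longrightarrow> xs ! Suc i \<in> nbhd F (xs ! i)"
    using xs by (auto simp: path_def n_def)
  have n0: "0 < n" using ne by (simp add: n_def)
  then have "xs ! 0 \<in> C" using sub by (auto simp: n_def)
  have card2: "card (nbhd F v) = 2" if "v \<in> C" for v
    using reg that by (simp add: two_regular_def)
  have first_nbhd: "nbhd F (xs ! 0) \<subseteq> set xs - {xs ! 0}"
  proof -
    \<comment> \<open>A neighbour off the path could be put in front of it, giving a longer
      path.\<close>
    have "y \<in> set xs" if y: "y \<in> nbhd F (xs ! 0)" for y
    proof (rule ccontr)
      assume "y \<notin> set xs"
      have "path (y # xs)"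
        unfolding path_def
      proof (intro conjI allI impI)
        show "set (y # xs) \<subseteq> C"
          using sub y nbhd_subset_internal[OF assms(5)] by auto
        show "(y # xs) ! Suc i \<in> nbhd F ((y # xs) ! i)" if "Suc i < length (y # xs)" for i
          using that y adj[of "i - 1"] by (cases i) (auto simp: n_def nbhd_sym)
      qed (use \<open>y \<notin> set xs\<close> dist in auto)
      then show False using longest by fastforce
    qed
    then show ?thesis using nbhd_irrefl[OF assms(4)] by blast
  qed
  have "2 \<le> card (set xs - {xs ! 0})"
    using card_mono[OF _ first_nbhd] card2[OF \<open>xs ! 0 \<in> C\<close>] by simp
  then have n3: "n \<ge> 3"
    using dist n0 by (simp add: card_Diff_singleton distinct_card n_def)
  have "nbhd F (xs ! 0) \<noteq> {xs ! 1}" "xs ! 1 \<in> nbhd F (xs ! 0)"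
    using card2[OF \<open>xs ! 0 \<in> C\<close>] adj[of 0] n3 by auto
  then obtain y where y: "y \<in> nbhd F (xs ! 0)" "y \<noteq> xs ! 1" by blast
  then have "y \<in> set xs" using first_nbhd by blast
  then obtain j where j: "j < n" "y = xs ! j"
    by (auto simp: in_set_conv_nth n_def)
  have j01: "j \<noteq> 0" "j \<noteq> 1"
    using j y first_nbhd by auto
  have "j = n - 1"
  proof (rule ccontr)
    assume "j \<noteq> n - 1"
    then have Sj: "Suc j < n" using j by simp
    \<comment> \<open>Since \<open>j\<close> is neither 0 nor 1, the indices 0, \<open>j - 1\<close>
      and \<open>Suc j\<close> are distinct, which gives \<open>xs ! j\<close> three
      neighbours.\<close>
    let ?T = "{xs ! 0, xs ! (j - 1), xs ! Suc j}"
    have "?T \<subseteq> nbhd F (xs ! j)"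
      using y(1) j adj[of j] adj[of "j - 1"] Sj j01 by (auto simp: nbhd_sym)
    moreover have "card ?T = 3"
    proof -
      have "j - 1 < length xs" "Suc j < length xs" "0 < length xs" "j - 1 \<noteq> 0" "j - 1 \<noteq> Suc j"
        using Sj j01 by (auto simp: n_def)
      then have "xs ! 0 \<noteq> xs ! (j - 1)" "xs ! 0 \<noteq> xs ! Suc j" "xs ! (j - 1) \<noteq> xs ! Suc j"
        using dist by (metis nth_eq_iff_index_eq old.nat.distinct(1))+
      then show ?thesis by simp
    qed
    ultimately have "3 \<le> card (nbhd F (xs ! j))"
      using card_mono[OF finite_nbhd[OF assms(3)]] by metis
    moreover have "xs ! j \<in> C"
      using sub nth_mem[of j xs] j(1) unfolding n_def by blast
    ultimately show False
      using card2[of "xs ! j"] by simp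
  qed
  have "is_cycle C F xs"
    unfolding is_cycle_def
  proof (intro conjI allI impI)
    fix i assume i: "i < length xs"
    have "cyc_next xs i \<in> nbhd F (xs ! i)"
    proof (cases "Suc i = n")
      case True
      then have "cyc_next xs i = xs ! 0" "i = j"
        using \<open>j = n - 1\<close> i by (simp_all add: cyc_next_nth n_def)
      then show ?thesis
        using y(1) j(2) nbhd_sym by metis
    next
      case False
      then show ?thesis
        using adj[of i] i by (auto simp: cyc_next_nth n_def)
    qed
    then show "(xs ! i, cyc_next xs i) \<in> F \<or> (cyc_next xs i, xs ! i) \<in> F"
      by (simp add: nbhd_def)
  qed (use n3 dist sub in \<open>auto simp: n_def\<close>)
  then show ?thesis ..
qed

section \<open>The Laplacian determinant of a cycle\<close>

text \<open>Orientation makes every step of the traversal either forward or backward, never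
  both.\<close>

lemma is_cycle_fwd_add_bwd:
  assumes "is_cycle C F vs" "oriented_arcs F"
  shows "{i. i < length vs \<and> (cyc_next vs i, vs ! i) \<in> F} =
      {i. i < length vs \<and> (vs ! i, cyc_next vs i) \<notin> F}"
    and "fwd_arcs F vs + bwd_arcs F vs = length vs"
proof -
  show eq: "{i. i < length vs \<and> (cyc_next vs i, vs ! i) \<in> F} =
      {i. i < length vs \<and> (vs ! i, cyc_next vs i) \<notin> F}"
    using assms by (auto simp: is_cycle_def oriented_arcs_def)
  have "fwd_arcs F vs + bwd_arcs F vs =
      card ({i. i < length vs \<and> (vs ! i, cyc_next vs i) \<in> F} \<union>
        {i. i < length vs \<and> (vs ! i, cyc_next vs i) \<notin> F})"
    unfolding fwd_arcs_def bwd_arcs_def eq by (rule card_Un_disjoint[symmetric]) auto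
  also have "\<dots> = card {..<length vs}"
    by (rule arg_cong[where f = card]) auto
  finally show "fwd_arcs F vs + bwd_arcs F vs = length vs" by simp
qed

text \<open>On the unit circle conjugate is inverse, so \<open>z ^ a * cnj z ^ b\<close> is the
  power with exponent |a - b| of \<open>z\<close> or of \<open>cnj z\<close>; the product of the two
  factors is unchanged by conjugation. The exponent is written as
  \<open>a + b - 2 * min a b\<close>, without truncation, to match k - 2g.\<close>

lemma unit_powers_norm_square:
  fixes z :: complex
  assumes "cmod z = 1"
  shows "(1 - z ^ a * cnj z ^ b) * (1 - cnj (z ^ a * cnj z ^ b)) =
    (1 - z ^ (a + b - 2 * min a b)) * (1 - cnj z ^ (a + b - 2 * min a b))"
proof -
  have z: "z * cnj z = 1"
    using assms by (metis complex_norm_square of_real_1 power_one)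
  have cancel: "z ^ n * cnj z ^ n = 1" for n
    using z by (metis power_mult_distrib power_one)
  show ?thesis
  proof (cases "a \<le> b")
    case True
    then obtain d where d: "b = a + d" by (auto simp: le_iff_add)
    have "z ^ a * cnj z ^ b = cnj z ^ d"
      using cancel[of a] by (simp add: d power_add mult.assoc[symmetric])
    then show ?thesis by (simp add: d mult.commute)
  next
    case False
    then obtain d where d: "a = b + d" by (metis le_iff_add nle_le)
    have "z ^ a * cnj z ^ b = z ^ d"
      using cancel[of b] by (simp add: d power_add mult_ac)
    then show ?thesis by (simp add: d)
  qed
qed

text \<open>Listed along the cycle, the Laplacian is the cyclic tridiagonal matrix above. The
  product of its weights has one factor \<omega> for each forward arc and one factor
  \<open>cnj \<omega>\<close> for each backward arc.\<close>

lemma det_two_regular_cycle: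
  assumes cyc: "is_cycle C F vs" and "finite F" "oriented_arcs F" "two_regular C F"
    and "indecomposable C F" "internal_arcs C F" and \<omega>: "cmod \<omega> = 1"
  defines "m \<equiv> length vs - 2 * neg_count F vs"
  shows "det_on C (herm_laplacian \<omega> F) = (1 - \<omega> ^ m) * (1 - cnj \<omega> ^ m)"
proof -
  let ?n = "length vs"
  \<comment> \<open>Up to sign, \<open>w i\<close> is the Laplacian entry from the
    \<open>i\<close>-th vertex of the cycle to the next.\<close>
  define w where "w i = (if (vs ! i, cyc_next vs i) \<in> F then \<omega> else cnj \<omega>)" for i
  have len: "?n \<ge> 3" and dist: "distinct vs"
    and adj: "\<And>i. i < ?n \<Longrightarrow> (vs ! i, cyc_next vs i) \<in> F \<or> (cyc_next vs i, vs ! i) \<in> F"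
    using cyc by (auto simp: is_cycle_def)
  have set_vs: "set vs = C"
    by (rule two_regular_cycle_covers[OF cyc assms(2,4,5,6)])
  have asym: "(v, u) \<notin> F" "u \<noteq> v" if "(u, v) \<in> F" for u v
    using assms(3) that by (auto simp: oriented_arcs_def)
  have entry: "herm_laplacian \<omega> F (vs ! i) (vs ! j) = (if i = j then 2
      else if j = Suc i mod ?n then - w i else if i = Suc j mod ?n then - cnj (w j) else 0)"
    if i: "i < ?n" and j: "j < ?n" for i j
  proof -
    have deg: "arc_degree F (vs ! i) = 2"
      using assms(4) i set_vs arc_degree_eq_card_nbhd[OF assms(3)] by (auto simp: two_regular_def)
    have "(vs ! j \<in> nbhd F (vs ! i)) \<longleftrightarrow> j = Suc i mod ?n \<or> i = Suc j mod ?n"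
    proof -
      have "Suc i mod ?n < ?n" using len by (intro mod_less_divisor) linarith
      then show ?thesis
        using is_cycle_nbhd_two_regular[OF cyc assms(2,4) i] dist j cyc_pred_less[OF i]
        by (auto simp: cyc_next_def nth_eq_iff_index_eq eq_Suc_mod_iff_cyc_pred[OF i j])
    qed
    then have non: "(vs ! i, vs ! j) \<notin> F" "(vs ! j, vs ! i) \<notin> F"
      if "j \<noteq> Suc i mod ?n" "i \<noteq> Suc j mod ?n"
      using that by (auto simp: nbhd_def)
    have ne: "vs ! i \<noteq> vs ! j" if "i \<noteq> j"
      using that i j dist by (simp add: nth_eq_iff_index_eq)
    consider "i = j" | "i \<noteq> j" "j = Suc i mod ?n"
      | "i \<noteq> j" "j \<noteq> Suc i mod ?n" "i = Suc j mod ?n"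
      | "i \<noteq> j" "j \<noteq> Suc i mod ?n" "i \<noteq> Suc j mod ?n" by blast
    then show ?thesis
    proof cases
      case 1
      then show ?thesis using deg by (simp add: herm_laplacian_def)
    next
      case 2
      then have "cyc_next vs i = vs ! j" by (simp add: cyc_next_def)
      then show ?thesis
        using 2(1) ne adj[OF i] 2(2)[symmetric] by (auto simp: herm_laplacian_def w_def)
    next
      case 3
      then have "cyc_next vs j = vs ! i" by (simp add: cyc_next_def)
      then show ?thesis
        using 3(1,2) ne adj[OF j] 3(3)[symmetric] asym by (auto simp: herm_laplacian_def w_def)
    next
      case 4
      then show ?thesis using ne non by (simp add: herm_laplacian_def)
    qed
  qed
  have "det_on C (herm_laplacian \<omega> F) = Determinant.det (mat ?n ?n (\<lambda>(i, j).
      herm_laplacian \<omega> F (vs ! i) (vs ! j)))"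
    using det_on_conv_det[OF dist] set_vs by simp
  also have "mat ?n ?n (\<lambda>(i, j). herm_laplacian \<omega> F (vs ! i) (vs ! j)) =
      mat ?n ?n (\<lambda>(i, j). if i = j then 2 else if j = Suc i mod ?n then - w i
        else if i = Suc j mod ?n then - cnj (w j) else 0)"
    by (rule eq_matI) (simp_all add: entry)
  also have "Determinant.det \<dots> = (1 - (\<Prod>i<?n. w i)) * (1 - cnj (\<Prod>i<?n. w i))"
    by (rule det_cyclic_tridiagonal[OF len]) (simp add: w_def \<omega>)
  also have "(\<Prod>i<?n. w i) = \<omega> ^ fwd_arcs F vs * cnj \<omega> ^ bwd_arcs F vs"
  proof -
    have "(\<Prod>i<?n. w i) = \<omega> ^ card ({..<?n} \<inter> {i. (vs ! i, cyc_next vs i) \<in> F}) *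
        cnj \<omega> ^ card ({..<?n} \<inter> - {i. (vs ! i, cyc_next vs i) \<in> F})"
      unfolding w_def by (subst prod.If_cases) auto
    also have "{..<?n} \<inter> {i. (vs ! i, cyc_next vs i) \<in> F} = {i. i < ?n \<and> (vs ! i, cyc_next vs i) \<in> F}"
      by auto
    also have "{..<?n} \<inter> - {i. (vs ! i, cyc_next vs i) \<in> F} =
        {i. i < ?n \<and> (cyc_next vs i, vs ! i) \<in> F}"
      unfolding is_cycle_fwd_add_bwd(1)[OF cyc assms(3)] by auto
    finally show ?thesis by (simp add: fwd_arcs_def bwd_arcs_def)
  qed
  finally show ?thesis
    using unit_powers_norm_square[OF \<omega>] is_cycle_fwd_add_bwd(2)[OF cyc assms(3)]
    by (simp add: m_def neg_count_def)
qed

section \<open>Deleting a vertex of degree one\<close>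

lemma arc_degree_one_cases:
  assumes "arc_degree F u = 1"
  obtains e v where "{e \<in> F. fst e = u \<or> snd e = u} = {e}" "e = (u, v) \<or> e = (v, u)"
proof -
  obtain e where e: "{e \<in> F. fst e = u \<or> snd e = u} = {e}"
    using assms unfolding arc_degree_def by (rule card_1_singletonE)
  then have "fst e = u \<or> snd e = u" by blast
  then have "e = (u, snd e) \<or> e = (fst e, u)" by (auto simp: prod_eq_iff)
  then show ?thesis using that e by metis
qed

text \<open>\<open>u\<close> has the single arc \<open>e\<close>, whose other end is
  \<open>v\<close>. No vertex set is fixed, so that the setting covers both an arc inside a
  component and one that leaves it.\<close>

locale leaf =
  fixes F :: "('a \<times> 'a) set" and u v :: 'a and e :: "'a \<times> 'a"
  assumes finite_F: "finite F" and oriented: "oriented_arcs F"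
    and incident: "{e \<in> F. fst e = u \<or> snd e = u} = {e}"
    and e_eq: "e = (u, v) \<or> e = (v, u)"
begin

lemma e_in_F: "e \<in> F"
  using incident by blast

lemma u_neq_v: "u \<noteq> v"
  using e_in_F e_eq oriented by (auto simp: oriented_arcs_def)

lemma nbhd_leaf: "nbhd F u = {v}"
proof -
  have "x = v" if "x \<in> nbhd F u" for x
  proof -
    have "(u, x) \<in> {e} \<or> (x, u) \<in> {e}"
      unfolding incident[symmetric] using that by (auto simp: nbhd_def)
    then show ?thesis using e_eq u_neq_v by auto
  qed
  moreover have "v \<in> nbhd F u" using e_in_F e_eq by (auto simp: nbhd_def)
  ultimately show ?thesis by blast
qed

lemma arc_away_iff: "a \<noteq> u \<Longrightarrow> b \<noteq> u \<Longrightarrow> (a, b) \<in> F - {e} \<longleftrightarrow> (a, b) \<in> F"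
  using e_eq by auto

lemma nbhd_remove: "a \<noteq> u \<Longrightarrow> nbhd (F - {e}) a = nbhd F a - {u}"
  using incident e_eq u_neq_v by (force simp: nbhd_def)

text \<open>Pivoting on the entry 1 at \<open>u\<close> can alter only the entry at (v, v), since
  \<open>v\<close> is the only neighbour of \<open>u\<close>. It drops by |\<omega>|^2 = 1, exactly
  the degree that \<open>v\<close> loses with \<open>e\<close>.\<close>

lemma det_remove_leaf:
  assumes "finite C" "u \<in> C" and \<omega>: "cmod \<omega> = 1"
  shows "det_on C (herm_laplacian \<omega> F) = det_on (C - {u}) (herm_laplacian \<omega> (F - {e}))"
proof -
  let ?M = "herm_laplacian \<omega> F"
  have oriented': "oriented_arcs (F - {e})"
    using oriented by (rule oriented_arcs_mono) blast
  have z: "\<omega> * cnj \<omega> = 1"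
    using \<omega> by (metis complex_norm_square of_real_1 power_one)
  have zero: "?M a u = 0" "?M u a = 0" if "a \<noteq> u" "a \<noteq> v" for a
  proof -
    have "a \<notin> nbhd F u" using that nbhd_leaf by simp
    then show "?M a u = 0" "?M u a = 0"
      using that by (auto simp: herm_laplacian_def nbhd_def)
  qed
  have "?M v u * ?M u v = 1"
    using e_eq e_in_F u_neq_v oriented_arcs_asym[OF oriented] z
    by (auto simp: herm_laplacian_def mult.commute)
  have "?M u u = 1"
    by (simp add: herm_laplacian_def arc_degree_eq_card_nbhd[OF oriented] nbhd_leaf)
  then have "det_on C ?M = det_on (C - {u}) (\<lambda>a b. ?M a b - ?M a u * ?M u b)"
    using assms by (intro det_on_pivot)
  also have "\<dots> = det_on (C - {u}) (herm_laplacian \<omega> (F - {e}))"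
  proof (rule det_on_cong)
    fix a b assume "a \<in> C - {u}" "b \<in> C - {u}"
    then have ab: "a \<noteq> u" "b \<noteq> u" by auto
    show "?M a b - ?M a u * ?M u b = herm_laplacian \<omega> (F - {e}) a b"
    proof (cases "a = b")
      case False
      \<comment> \<open>At most one of \<open>a\<close> and \<open>b\<close> equals
        \<open>v\<close>, so at least one factor vanishes.\<close>
      then have "?M a u * ?M u b = 0"
        using zero ab by (cases "a = v") auto
      moreover have "?M a b = herm_laplacian \<omega> (F - {e}) a b"
        using False ab by (simp add: herm_laplacian_def arc_away_iff del: Diff_iff)
      ultimately show ?thesis by simp
    next
      case True
      have "?M a a - ?M a u * ?M u a = herm_laplacian \<omega> (F - {e}) a a"
      proof (cases "a = v")
        case True
        have "u \<in> nbhd F v" using nbhd_leaf nbhd_sym by fast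
        then have "card (nbhd F v) = Suc (card (nbhd F v - {u}))"
          using finite_nbhd[OF finite_F] by (metis card_Suc_Diff1)
        then show ?thesis
          using True \<open>?M v u * ?M u v = 1\<close> ab
          by (simp add: herm_laplacian_def[of _ _ v v] nbhd_remove
              arc_degree_eq_card_nbhd[OF oriented] arc_degree_eq_card_nbhd[OF oriented'])
      next
        case False
        then have "u \<notin> nbhd F a" using nbhd_leaf nbhd_sym by fast
        then show ?thesis
          using False zero ab
          by (simp add: herm_laplacian_def[of _ _ a a] nbhd_remove
              arc_degree_eq_card_nbhd[OF oriented] arc_degree_eq_card_nbhd[OF oriented'])
      qed
      then show ?thesis using True by simp
    qed
  qed
  finally show ?thesis .
qed

text \<open>A vertex on a cycle has at least two neighbours.\<close>

lemma cycle_avoids_leaf: "is_cycle C F vs \<Longrightarrow> u \<notin> set vs"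
  using is_cycle_card_nbhd[OF _ finite_F, of C vs u] nbhd_leaf by auto

lemma cyc_next_neq_leaf: "u \<notin> set vs \<Longrightarrow> i < length vs \<Longrightarrow> cyc_next vs i \<noteq> u"
  unfolding cyc_next_def by (metis length_pos_if_in_set mod_less_divisor nth_mem)

lemma cycle_arc_iff:
  assumes "u \<notin> set vs" "i < length vs"
  shows "(vs ! i, cyc_next vs i) \<in> F - {e} \<longleftrightarrow> (vs ! i, cyc_next vs i) \<in> F"
    "(cyc_next vs i, vs ! i) \<in> F - {e} \<longleftrightarrow> (cyc_next vs i, vs ! i) \<in> F"
proof -
  have "vs ! i \<noteq> u" using assms by auto
  then show "(vs ! i, cyc_next vs i) \<in> F - {e} \<longleftrightarrow> (vs ! i, cyc_next vs i) \<in> F"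
    "(cyc_next vs i, vs ! i) \<in> F - {e} \<longleftrightarrow> (cyc_next vs i, vs ! i) \<in> F"
    using cyc_next_neq_leaf[OF assms] by (simp_all add: arc_away_iff del: Diff_iff)
qed

text \<open>No cycle passes through \<open>u\<close>, so none uses the arc \<open>e\<close>.\<close>

lemma is_cycle_remove_leaf: "is_cycle (C - {u}) (F - {e}) vs \<longleftrightarrow> is_cycle C F vs"
proof
  assume "is_cycle (C - {u}) (F - {e}) vs"
  then show "is_cycle C F vs" by (auto simp: is_cycle_def)
next
  assume cyc: "is_cycle C F vs"
  have "u \<notin> set vs" using cyc by (rule cycle_avoids_leaf)
  then show "is_cycle (C - {u}) (F - {e}) vs"
    using cyc cycle_arc_iff[of vs] unfolding is_cycle_def by blast
qed

lemma
  assumes "is_cycle C F vs"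
  shows cycle_arcs_remove_leaf: "cycle_arcs (F - {e}) vs = cycle_arcs F vs"
    and neg_count_remove_leaf: "neg_count (F - {e}) vs = neg_count F vs"
proof -
  note iff = cycle_arc_iff[OF cycle_avoids_leaf[OF assms]]
  show "cycle_arcs (F - {e}) vs = cycle_arcs F vs"
    unfolding cycle_arcs_def using iff by blast
  show "neg_count (F - {e}) vs = neg_count F vs"
    unfolding neg_count_def fwd_arcs_def bwd_arcs_def
    by (intro arg_cong2[where f = min] arg_cong[where f = card] Collect_cong conj_cong refl iff)
qed

end

context regular_component
begin

text \<open>Here \<open>{u}\<close> is closed under neighbours inside \<open>C\<close>, so
  indecomposability applies to it.\<close>

lemma singleton_if_leaf_arc_external:
  assumes "leaf F u v e" "u \<in> C" "v \<notin> C"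
  shows "C = {u}"
proof -
  have "nbhd F u \<inter> C \<subseteq> {u}"
    using leaf.nbhd_leaf[OF assms(1)] assms(3) by auto
  then show ?thesis
    using indec assms(2) unfolding indecomposable_def by blast
qed

text \<open>One vertex and one arc disappear, so the counts stay equal. The arc \<open>e\<close> has
  both ends in \<open>C\<close> and all other arcs avoid \<open>u\<close>, so whether an arc leaves
  the component does not change.\<close>

lemma regular_component_remove_leaf:
  assumes "leaf F u v e" "u \<in> C" "v \<in> C"
  shows "regular_component (C - {u}) (F - {e})"
    and "internal_arcs (C - {u}) (F - {e}) \<longleftrightarrow> internal_arcs C F"
proof -
  interpret leaf F u v e by fact
  have away: "fst e' \<noteq> u" "snd e' \<noteq> u" if "e' \<in> F - {e}" for e'
    using that incident by blast+
  show "regular_component (C - {u}) (F - {e})"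
  proof
    show "C - {u} \<noteq> {}" using assms(3) u_neq_v by blast
    show "oriented_arcs (F - {e})" using oriented by (rule oriented_arcs_mono) blast
    show "fst e' \<in> C - {u} \<or> snd e' \<in> C - {u}" if "e' \<in> F - {e}" for e'
      using touching[of e'] away[OF that] that by blast
    show "card (C - {u}) = card (F - {e})"
      using card_eq assms(2) e_in_F by simp
    show "indecomposable (C - {u}) (F - {e})"
      unfolding indecomposable_def
    proof (intro allI impI)
      fix S assume S: "S \<subseteq> C - {u}" "S \<noteq> {}" "\<forall>a\<in>S. nbhd (F - {e}) a \<inter> (C - {u}) \<subseteq> S"
      \<comment> \<open>A closed set of the smaller component becomes closed in \<open>C\<close>
        once \<open>u\<close> is added exactly when its neighbour \<open>v\<close> belongs to the
        set.\<close>
      define T where "T = (if v \<in> S then insert u S else S)"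
      have "nbhd F a \<inter> C \<subseteq> T" if "a \<in> T" for a
      proof (cases "a = u")
        case True
        then have "v \<in> S" using that S(1) by (auto simp: T_def split: if_splits)
        then show ?thesis using True nbhd_leaf by (auto simp: T_def)
      next
        case False
        then have "a \<in> S" using that by (auto simp: T_def split: if_splits)
        then have "nbhd F a \<inter> C \<subseteq> insert u S"
          using S(3) nbhd_remove[OF False] by blast
        moreover have "v \<in> S" if "u \<in> nbhd F a"
          using that nbhd_leaf nbhd_sym \<open>a \<in> S\<close> by fast
        ultimately show ?thesis by (auto simp: T_def)
      qed
      moreover have "T \<subseteq> C" "T \<noteq> {}"
        using S(1,2) assms(2) by (auto simp: T_def)
      ultimately have "T = C"
        using indec unfolding indecomposable_def by blast
      then show "S = C - {u}"
        using S(1) by (auto simp: T_def split: if_splits)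
    qed
  qed (use finite_C finite_F in auto)
  show "internal_arcs (C - {u}) (F - {e}) \<longleftrightarrow> internal_arcs C F"
  proof
    assume *: "internal_arcs (C - {u}) (F - {e})"
    have "fst e \<in> C \<and> snd e \<in> C" using assms(2,3) e_eq by auto
    then show "internal_arcs C F" using * unfolding internal_arcs_def by blast
  qed (use away in \<open>auto simp: internal_arcs_def\<close>)
qed

end

section \<open>The determinant of a single component\<close>

text \<open>Leaves are deleted by induction on the number of vertices; determinant, cycles and the
  presence of leaving arcs are preserved. The witness \<open>vs\<close> is chosen before \<omega>,
  so that one exponent serves all the \<omega> in the final product, and the uniqueness of the arc
  set yields \<open>unicyclic_comp\<close>.\<close>

lemma regular_component_det:
  assumes "regular_component C F"
  shows "\<not> internal_arcs C F \<and> (\<forall>\<omega>. cmod \<omega> = 1 \<longrightarrow> det_on C (herm_laplacian \<omega> F) = 1) \<or>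
    internal_arcs C F \<and> (\<exists>vs. is_cycle C F vs \<and>
      (\<forall>vs'. is_cycle C F vs' \<longrightarrow> cycle_arcs F vs' = cycle_arcs F vs) \<and>
      (\<forall>\<omega>. cmod \<omega> = 1 \<longrightarrow> det_on C (herm_laplacian \<omega> F) =
        (1 - \<omega> ^ (length vs - 2 * neg_count F vs)) * (1 - cnj \<omega> ^ (length vs - 2 * neg_count F vs))))"
  using assms
proof (induction "card C" arbitrary: C F rule: less_induct)
  case less
  interpret regular_component C F by fact
  show ?case
  proof (cases "\<exists>u\<in>C. arc_degree F u = 1")
    case False
    then have reg: "two_regular C F" and int: "internal_arcs C F"
      using leafless_two_regular by blast+
    obtain vs where vs: "is_cycle C F vs"
      using two_regular_has_cycle[OF finite_C C_nonempty finite_F oriented int reg] by blast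
    have "cycle_arcs F vs' = F" if "is_cycle C F vs'" for vs'
      using two_regular_cycle_covers(2)[OF that finite_F reg indec int] .
    then show ?thesis
      using vs int det_two_regular_cycle[OF vs finite_F oriented reg indec int] by metis
  next
    case True
    then obtain u where u: "u \<in> C" "arc_degree F u = 1" by blast
    obtain e v where ev: "{e \<in> F. fst e = u \<or> snd e = u} = {e}" "e = (u, v) \<or> e = (v, u)"
      using arc_degree_one_cases[OF u(2)] .
    interpret leaf F u v e
      by unfold_locales (use finite_F oriented ev in auto)
    have leaf: "leaf F u v e" ..
    have det: "det_on C (herm_laplacian \<omega> F) = det_on (C - {u}) (herm_laplacian \<omega> (F - {e}))"
      if "cmod \<omega> = 1" for \<omega>
      using det_remove_leaf[OF finite_C u(1) that] .
    show ?thesis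
    proof (cases "v \<in> C")
      case False
      then have "C = {u}" using singleton_if_leaf_arc_external[OF leaf u(1)] by simp
      moreover have "\<not> internal_arcs C F"
        using e_in_F e_eq False unfolding internal_arcs_def by (metis fst_conv snd_conv)
      \<comment> \<open>Deleting \<open>u\<close> empties the vertex set, and the determinant over
        the empty set is 1.\<close>
      ultimately show ?thesis using det by simp
    next
      case True
      note sub = regular_component_remove_leaf[OF leaf u(1) True]
      have "card (C - {u}) < card C"
        using finite_C u(1) by (rule card_Diff1_less)
      from less.hyps[OF this sub(1)] show ?thesis
        using det unfolding sub(2) is_cycle_remove_leaf
        by (metis cycle_arcs_remove_leaf neg_count_remove_leaf)
    qed
  qed
qed

subsection \<open>Decomposition into components\<close>

lemma conn_rel_sym: "(u, v) \<in> conn_rel V F \<Longrightarrow> (v, u) \<in> conn_rel V F"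
proof -
  have "sym (conn_rel V F)"
    unfolding conn_rel_def by (rule sym_rtrancl) (auto simp: sym_def)
  then show "(u, v) \<in> conn_rel V F \<Longrightarrow> (v, u) \<in> conn_rel V F"
    by (rule symD)
qed

lemma conn_rel_trans: "(u, v) \<in> conn_rel V F \<Longrightarrow> (v, w) \<in> conn_rel V F \<Longrightarrow> (u, w) \<in> conn_rel V F"
  unfolding conn_rel_def by (rule rtrancl_trans)

lemma conn_rel_nbhd: "u \<in> V \<Longrightarrow> v \<in> V \<Longrightarrow> v \<in> nbhd F u \<Longrightarrow> (u, v) \<in> conn_rel V F"
  unfolding conn_rel_def by (rule r_into_rtrancl) (auto simp: nbhd_def)

text \<open>The reflexive closure relates every point to itself, also outside \<open>V\<close>,
  hence the condition on the starting point.\<close>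

lemma conn_rel_closed: "(u, v) \<in> conn_rel V F \<Longrightarrow> u \<in> V \<Longrightarrow> v \<in> V"
  unfolding conn_rel_def by (erule rtrancl_induct) auto

lemma comp_class_eq:
  assumes "C \<in> comp_classes V F" "u \<in> C"
  shows "C = conn_rel V F `` {u}"
  using assms by (auto simp: comp_classes_def intro: conn_rel_sym conn_rel_trans)

lemma comp_class_subset: "C \<in> comp_classes V F \<Longrightarrow> C \<subseteq> V"
  by (auto simp: comp_classes_def intro: conn_rel_closed)

lemma comp_class_nonempty: "C \<in> comp_classes V F \<Longrightarrow> C \<noteq> {}"
  by (auto simp: comp_classes_def conn_rel_def)

lemma Union_comp_classes: "\<Union>(comp_classes V F) = V"
proof
  show "V \<subseteq> \<Union>(comp_classes V F)"
  proof
    fix v assume "v \<in> V"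
    then have "conn_rel V F `` {v} \<in> comp_classes V F" by (auto simp: comp_classes_def)
    moreover have "v \<in> conn_rel V F `` {v}" by (simp add: conn_rel_def)
    ultimately show "v \<in> \<Union>(comp_classes V F)" by blast
  qed
qed (use comp_class_subset in blast)

lemma pairwise_disjnt_comp_classes: "pairwise disjnt (comp_classes V F)"
  unfolding pairwise_def disjnt_def by (metis comp_class_eq disjoint_iff)

lemma finite_comp_classes: "finite V \<Longrightarrow> finite (comp_classes V F)"
  by (rule finite_subset[of _ "Pow V"]) (auto dest: comp_class_subset)

text \<open>A closed subset containing \<open>s\<close> absorbs every path from \<open>s\<close>, by
  induction along the path.\<close>

lemma comp_class_indecomposable:
  assumes C: "C \<in> comp_classes V F"
  shows "indecomposable C (comp_arcs F C)"
  unfolding indecomposable_def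
proof (intro allI impI)
  fix S assume S: "S \<subseteq> C" "S \<noteq> {}" "\<forall>u\<in>S. nbhd (comp_arcs F C) u \<inter> C \<subseteq> S"
  then obtain s where s: "s \<in> S" by blast
  have C_eq: "C = conn_rel V F `` {s}"
    using comp_class_eq[OF C] s S(1) by blast
  have "t \<in> S" if "(s, t) \<in> conn_rel V F" for t
    using that unfolding conn_rel_def
  proof (induction rule: rtrancl_induct)
    case (step x y)
    then have "x \<in> C" "y \<in> nbhd F x" "(x, y) \<in> conn_rel V F"
      using S(1) by (auto simp: nbhd_def conn_rel_def)
    then have "y \<in> C" "y \<in> nbhd (comp_arcs F C) x"
      using comp_class_eq[OF C] by (auto simp: nbhd_def comp_arcs_def)
    then show ?case using S(3) step.IH by blast
  qed (rule s)
  then show "S = C" using S(1) C_eq by blast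
qed

lemma comp_class_regular_component:
  assumes "finite V" "finite F" "oriented_arcs F" "all_regular V F" and C: "C \<in> comp_classes V F"
  shows "regular_component C (comp_arcs F C)"
proof
  show "finite C" using assms(1) comp_class_subset[OF C] by (rule finite_subset[rotated])
  show "oriented_arcs (comp_arcs F C)"
    using assms(3) by (rule oriented_arcs_mono) (auto simp: comp_arcs_def)
  show "card C = card (comp_arcs F C)" using assms(4) C by (simp add: all_regular_def)
qed (use assms(2) comp_class_nonempty[OF C] comp_class_indecomposable[OF C]
    in \<open>auto simp: comp_arcs_def\<close>)

text \<open>\<open>comp_arcs\<close> keeps every arc with an end in \<open>C\<close>, including
  those that leave \<open>C\<close>, so the degrees in \<open>C\<close> do not change.\<close>

lemma herm_laplacian_comp_arcs:
  assumes "u \<in> C" "v \<in> C"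
  shows "herm_laplacian \<omega> (comp_arcs F C) u v = herm_laplacian \<omega> F u v"
proof -
  have "arc_degree (comp_arcs F C) x = arc_degree F x" if "x \<in> C" for x
    unfolding arc_degree_def using that by (intro arg_cong[where f = card]) (auto simp: comp_arcs_def)
  then show ?thesis
    using assms by (simp add: herm_laplacian_def) (simp add: comp_arcs_def)
qed

section \<open>The product over all components\<close>

text \<open>Adjacent vertices of \<open>V\<close> lie in the same class, so the Laplacian is block
  diagonal over the classes.\<close>

lemma det_herm_laplacian_components:
  assumes "finite V"
  shows "det_on V (herm_laplacian \<omega> F) =
    (\<Prod>C\<in>comp_classes V F. det_on C (herm_laplacian \<omega> (comp_arcs F C)))"
proof -
  have "det_on (\<Union>(comp_classes V F)) (herm_laplacian \<omega> F) =
      (\<Prod>C\<in>comp_classes V F. det_on C (herm_laplacian \<omega> F))"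
  proof (rule det_on_Union_block)
    show "finite C" if "C \<in> comp_classes V F" for C
      using comp_class_subset[OF that] assms by (rule finite_subset)
    fix A B u v
    assume A: "A \<in> comp_classes V F" and B: "B \<in> comp_classes V F" and "A \<noteq> B"
      and u: "u \<in> A" and v: "v \<in> B"
    have "(u, v) \<notin> conn_rel V F"
    proof
      assume "(u, v) \<in> conn_rel V F"
      then have "v \<in> A" using comp_class_eq[OF A u] by blast
      then show False using comp_class_eq[OF A] comp_class_eq[OF B v] \<open>A \<noteq> B\<close> by metis
    qed
    moreover have "u \<in> V" "v \<in> V" using comp_class_subset A B u v by blast+
    ultimately have "v \<notin> nbhd F u" "u \<noteq> v"
      using conn_rel_nbhd by (fast, auto simp: conn_rel_def)
    then show "herm_laplacian \<omega> F u v = 0"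
      by (simp add: herm_laplacian_def nbhd_def)
  qed (use assms finite_comp_classes pairwise_disjnt_comp_classes in auto)
  also have "\<dots> = (\<Prod>C\<in>comp_classes V F. det_on C (herm_laplacian \<omega> (comp_arcs F C)))"
    by (intro prod.cong refl det_on_cong) (simp add: herm_laplacian_comp_arcs)
  finally show ?thesis by (simp add: Union_comp_classes)
qed

text \<open>If an arc leaves the component, it is not unicyclic and every factor is 1. Otherwise it
  is unicyclic, and being non-\<open>p\<close>-vanishing says that \<open>p\<close> does not divide
  the exponent, so the root of unity product gives \<open>p\<close>.\<close>

lemma prod_det_component:
  assumes p: "prime p" "odd p" and comp: "regular_component C (comp_arcs F C)"
    and nonvan: "\<not> p_vanishing p F C"
  shows "(\<Prod>q = 1..(p - 1) div 2. det_on C (herm_laplacian (omega_pq p q) (comp_arcs F C)))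
    = (if unicyclic_comp F C then of_nat p else 1)"
proof -
  let ?F = "comp_arcs F C"
  have norm: "cmod (omega_pq p q) = 1" for q
    by (simp add: omega_pq_def)
  from regular_component_det[OF comp] consider
      "\<not> internal_arcs C ?F" "\<And>\<omega>. cmod \<omega> = 1 \<Longrightarrow> det_on C (herm_laplacian \<omega> ?F) = 1"
    | vs where "internal_arcs C ?F" "is_cycle C ?F vs"
      "\<And>vs'. is_cycle C ?F vs' \<Longrightarrow> cycle_arcs ?F vs' = cycle_arcs ?F vs"
      "\<And>\<omega>. cmod \<omega> = 1 \<Longrightarrow> det_on C (herm_laplacian \<omega> ?F) =
        (1 - \<omega> ^ (length vs - 2 * neg_count ?F vs)) * (1 - cnj \<omega> ^ (length vs - 2 * neg_count ?F vs))"
    by blast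
  then show ?thesis
  proof cases
    case 1
    then have "\<not> unicyclic_comp F C"
      by (auto simp: unicyclic_comp_def internal_arcs_def)
    then show ?thesis using 1(2) norm by simp
  next
    case 2
    have uni: "unicyclic_comp F C"
      unfolding unicyclic_comp_def using 2(1-3) unfolding internal_arcs_def by blast
    then have "\<not> p dvd length vs - 2 * neg_count ?F vs"
      using nonvan 2(2) unfolding p_vanishing_def by blast
    then show ?thesis
      using prod_norm_square_one_minus_omega[OF p] 2(4)[OF norm] uni by simp
  qed
qed

theorem mainTheorem16:
  fixes p :: nat and V V' :: "'a set" and E E' :: "('a \<times> 'a) set"
  assumes "prime p" and "odd p"
    and "oriented_graph V E"
    and "substructure V E V' E'"
    and "all_regular V' E'"
    and "\<forall>C \<in> comp_classes V' E'. \<not> p_vanishing p E' C"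
  shows "(\<Prod>q = 1..(p - 1) div 2. det_on V' (herm_laplacian (omega_pq p q) E'))
           = of_nat p ^ card {C \<in> comp_classes V' E'. unicyclic_comp E' C}"
proof -
  have finite_V: "finite V'"
    using assms(3,4) by (auto simp: oriented_graph_def substructure_def intro: finite_subset)
  have finite_E: "finite E'"
    using assms(3,4) unfolding oriented_graph_def substructure_def
    by (meson finite_SigmaI finite_subset)
  have oriented: "oriented_arcs E'"
    using assms(3,4) oriented_arcs_mono[of E E']
    by (simp add: oriented_graph_def substructure_def oriented_arcs_def)
  \<comment> \<open>For each \<open>q\<close> the determinant splits over the components; exchanging
    the two products collects all \<open>q\<close> for one component.\<close>
  have "(\<Prod>q = 1..(p - 1) div 2. det_on V' (herm_laplacian (omega_pq p q) E')) =
      (\<Prod>C\<in>comp_classes V' E'. \<Prod>q = 1..(p - 1) div 2.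
        det_on C (herm_laplacian (omega_pq p q) (comp_arcs E' C)))"
    unfolding det_herm_laplacian_components[OF finite_V] by (rule prod.swap)
  also have "\<dots> = (\<Prod>C\<in>comp_classes V' E'. if unicyclic_comp E' C then of_nat p else 1)"
    using assms(6) comp_class_regular_component[OF finite_V finite_E oriented assms(5)]
    by (intro prod.cong refl prod_det_component[OF assms(1,2)]) auto
  also have "\<dots> = of_nat p ^ card (comp_classes V' E' \<inter> {C. unicyclic_comp E' C})"
    using finite_comp_classes[OF finite_V] by (simp add: prod.If_cases)
  also have "comp_classes V' E' \<inter> {C. unicyclic_comp E' C} =
      {C \<in> comp_classes V' E'. unicyclic_comp E' C}"
    by blast
  finally show ?thesis .
qed

end
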